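(* Let $(G(V_g,E_g),p(\cdot,\cdot))$ be a sampled graph whose bivariate distribution $p(\cdot,\cdot)$ has the same marginal distributions, i.e. $p_V(v)=p_W(v)$ for all $v\in V_g$. Let $S\subset V_g$ be a set of nodes with $0<C(S)<1$, and let $S^c=V_g\setminus S$. Then the following statements are equivalent. (i) $S$ is a community, i.e., $Str(S)=C(S|S)-C(S)\ge 0$. (ii) $C(S|S)\ge C(S|S^c)$. (iii) $C(S^c|S)\le C(S^c)$. (iv) $C(S|S^c)\le C(S)$. (v) $S^c$ is a community, i.e., $Str(S^c)=C(S^c|S^c)-C(S^c)\ge 0$. (vi) $C(S^c|S^c)\ge C(S^c|S)$.
   Context: A sampled graph $(G(V_g,E_g),p(\cdot,\cdot))$ consists of a finite (possibly directed) graph with vertex set $V_g=\{1,\dots,n\}$ and edge set $E_g$, together with a probability distribution $p$ on $V_g\times V_g$ (not necessarily symmetric), which is the joint law of a random ordered pair of nodes $(V,W)$: $\mathsf{P}(V=v,W=w)=p(v,w)$. Its marginals are $p_V(v)=\sum_{w}p(v,w)$ and $p_W(w)=\sum_{v}p(v,w)$. Assume $p_V=p_W$. For $S\subset V_g$, the centrality of $S$ is $C(S)=\mathsf{P}(V\in S)=\mathsf{P}(W\in S)$. For $S_1,S_2\subset V_g$, the relative centrality of $S_1$ with respect to $S_2$ is $C(S_1|S_2)=\mathsf{P}(W\in S_1\mid V\in S_2)$. The community strength of $S$ is $Str(S)=C(S|S)-C(S)$, and $S$ is called a community if $Str(S)\ge 0$. *)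

theory Defs
  imports "HOL-Probability.Probability"
begin

(* The edge set consists of ordered pairs; an undirected graph has both orientations of
   each edge. The distribution p is the joint law of the random pair (V, W), i.e.
   p(v, w) = pmf p (v, w), and it is not tied to the edge set. *)
locale sampled_graph =
  fixes n :: nat and E :: "(nat \<times> nat) set" and p :: "(nat \<times> nat) pmf"
  assumes edges: "E \<subseteq> {1..n} \<times> {1..n}"
    and support: "set_pmf p \<subseteq> {1..n} \<times> {1..n}"

definition marginal_V :: "nat \<Rightarrow> (nat \<times> nat) pmf \<Rightarrow> nat \<Rightarrow> real" where
  "marginal_V n p v = (\<Sum>w\<in>{1..n}. pmf p (v, w))"

definition marginal_W :: "nat \<Rightarrow> (nat \<times> nat) pmf \<Rightarrow> nat \<Rightarrow> real" where
  "marginal_W n p w = (\<Sum>v\<in>{1..n}. pmf p (v, w))"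

(* P(V \<in> S); it agrees with P(W \<in> S) when the marginals coincide,
   see centrality_eq_prob_W below. *)
definition centrality :: "(nat \<times> nat) pmf \<Rightarrow> nat set \<Rightarrow> real" where
  "centrality p S = measure_pmf.prob p {(v, w). v \<in> S}"

definition relative_centrality :: "(nat \<times> nat) pmf \<Rightarrow> nat set \<Rightarrow> nat set \<Rightarrow> real" where
  "relative_centrality p S1 S2 = cond_prob (measure_pmf p) (\<lambda>(v, w). w \<in> S1) (\<lambda>(v, w). v \<in> S2)"

definition community_strength :: "(nat \<times> nat) pmf \<Rightarrow> nat set \<Rightarrow> real" where
  "community_strength p S = relative_centrality p S S - centrality p S"

definition is_community :: "(nat \<times> nat) pmf \<Rightarrow> nat set \<Rightarrow> bool" where
  "is_community p S \<longleftrightarrow> community_strength p S \<ge> 0"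

lemma (in sampled_graph) prob_V_eq_sum_marginal:
  assumes "S \<subseteq> {1..n}"
  shows "measure_pmf.prob p {(v, w). v \<in> S} = (\<Sum>v\<in>S. marginal_V n p v)"
proof -
  have fin: "finite S" using assms finite_subset by blast
  have "measure_pmf.prob p {(v, w). v \<in> S} = measure_pmf.prob p (S \<times> {1..n})"
    using support by (intro measure_pmf.finite_measure_eq_AE) (auto simp: AE_measure_pmf_iff)
  also have "\<dots> = (\<Sum>x\<in>S \<times> {1..n}. pmf p x)"
    using fin by (intro measure_measure_pmf_finite) auto
  also have "\<dots> = (\<Sum>v\<in>S. marginal_V n p v)"
    by (simp add: marginal_V_def sum.cartesian_product)
  finally show ?thesis .
qed

lemma (in sampled_graph) prob_W_eq_sum_marginal:
  assumes "S \<subseteq> {1..n}"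
  shows "measure_pmf.prob p {(v, w). w \<in> S} = (\<Sum>w\<in>S. marginal_W n p w)"
proof -
  have fin: "finite S" using assms finite_subset by blast
  have "measure_pmf.prob p {(v, w). w \<in> S} = measure_pmf.prob p ({1..n} \<times> S)"
    using support by (intro measure_pmf.finite_measure_eq_AE) (auto simp: AE_measure_pmf_iff)
  also have "\<dots> = (\<Sum>x\<in>{1..n} \<times> S. pmf p x)"
    using fin by (intro measure_measure_pmf_finite) auto
  also have "\<dots> = (\<Sum>v\<in>{1..n}. \<Sum>w\<in>S. pmf p (v, w))"
    by (simp add: sum.cartesian_product)
  also have "\<dots> = (\<Sum>w\<in>S. marginal_W n p w)"
    unfolding marginal_W_def by (rule sum.swap)
  finally show ?thesis .
qed

lemma (in sampled_graph) centrality_eq_prob_W: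
  assumes "\<forall>v\<in>{1..n}. marginal_V n p v = marginal_W n p v" and "S \<subseteq> {1..n}"
  shows "centrality p S = measure_pmf.prob p {(v, w). w \<in> S}"
  unfolding centrality_def prob_V_eq_sum_marginal[OF assms(2)] prob_W_eq_sum_marginal[OF assms(2)]
  using assms by (intro sum.cong) auto

end

(* With c = C(S) and a = P(V \<in> S, W \<in> S), equality of the marginals gives
   P(V \<in> S, W \<notin> S) = P(V \<notin> S, W \<in> S) = c - a, so every quantity in
   the theorem is a function of a and c, and each of the six conditions amounts to
   a \<ge> c^2. *)
theory Submission
  imports Defs
begin

text \<open>The order flips because the second argument is the conditioning event on V, the first
  coordinate. If \<open>centrality p A\<close> is 0, both sides are 0 by the convention for division
  by zero.\<close>

lemma relative_centrality_eq_prob_Times: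
  "relative_centrality p B A = measure_pmf.prob p (A \<times> B) / centrality p A"
proof -
  have "{x. (case x of (v, w) \<Rightarrow> w \<in> B) \<and> (case x of (v, w) \<Rightarrow> v \<in> A)} = A \<times> B"
    and "{x. case x of (v, w) \<Rightarrow> v \<in> A} = {(v, w). v \<in> A}"
    by auto
  then show ?thesis
    by (simp add: relative_centrality_def cond_prob_def centrality_def)
qed

context sampled_graph
begin

text \<open>By \<open>support\<close>, W lies in \<open>{1..n}\<close> almost surely, so splitting
  on whether W is in \<open>B\<close> loses only a null set.\<close>

lemma prob_Times_add_prob_Times_Diff:
  "measure_pmf.prob p (A \<times> B) + measure_pmf.prob p (A \<times> ({1..n} - B)) = centrality p A"
proof -
  have "measure_pmf.prob p (A \<times> B) + measure_pmf.prob p (A \<times> ({1..n} - B))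
      = measure_pmf.prob p (A \<times> B \<union> A \<times> ({1..n} - B))"
    by (subst measure_pmf.finite_measure_Union) auto
  also have "\<dots> = centrality p A"
    unfolding centrality_def using support
    by (intro measure_pmf.finite_measure_eq_AE) (auto simp: AE_measure_pmf_iff)
  finally show ?thesis .
qed

text \<open>The same split on V. The total is a probability for W, which becomes a centrality only
  once the marginals agree.\<close>

lemma prob_Times_add_prob_Diff_Times:
  "measure_pmf.prob p (A \<times> B) + measure_pmf.prob p (({1..n} - A) \<times> B)
    = measure_pmf.prob p {(v, w). w \<in> B}"
proof -
  have "measure_pmf.prob p (A \<times> B) + measure_pmf.prob p (({1..n} - A) \<times> B)
      = measure_pmf.prob p (A \<times> B \<union> ({1..n} - A) \<times> B)"
    by (subst measure_pmf.finite_measure_Union) auto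
  also have "\<dots> = measure_pmf.prob p {(v, w). w \<in> B}"
    using support by (intro measure_pmf.finite_measure_eq_AE) (auto simp: AE_measure_pmf_iff)
  finally show ?thesis .
qed

lemma centrality_Diff: "centrality p ({1..n} - A) = 1 - centrality p A"
proof -
  have "centrality p ({1..n} - A) = measure_pmf.prob p (UNIV - {(v, w). v \<in> A})"
    unfolding centrality_def using support
    by (intro measure_pmf.finite_measure_eq_AE) (auto simp: AE_measure_pmf_iff)
  also have "\<dots> = 1 - centrality p A"
    using measure_pmf.prob_compl[of "{(v, w). v \<in> A}" p] by (simp add: centrality_def)
  finally show ?thesis .
qed

end

theorem theorem7:
  fixes n :: nat and E :: "(nat \<times> nat) set" and p :: "(nat \<times> nat) pmf" and S Sc :: "nat set"
  assumes "sampled_graph n E p"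
    and "\<forall>v\<in>{1..n}. marginal_V n p v = marginal_W n p v"
    and "S \<subseteq> {1..n}"
    and "Sc = {1..n} - S"
    and "0 < centrality p S" and "centrality p S < 1"
  shows "(is_community p S \<longleftrightarrow> relative_centrality p S S \<ge> relative_centrality p S Sc)
    \<and> (is_community p S \<longleftrightarrow> relative_centrality p Sc S \<le> centrality p Sc)
    \<and> (is_community p S \<longleftrightarrow> relative_centrality p S Sc \<le> centrality p S)
    \<and> (is_community p S \<longleftrightarrow> is_community p Sc)
    \<and> (is_community p S \<longleftrightarrow> relative_centrality p Sc Sc \<ge> relative_centrality p Sc S)"
proof -
  interpret sampled_graph n E p by fact
  define c where "c = centrality p S"
  define a where "a = measure_pmf.prob p (S \<times> S)"
  \<comment> \<open>These are the two denominators below; their positivity allows the inequalities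
    to be cleared of fractions.\<close>
  have c: "0 < c" "0 < 1 - c"
    using assms by (simp_all add: c_def)
  have cSc: "centrality p Sc = 1 - c"
    using assms centrality_Diff c_def by simp
  have "measure_pmf.prob p (S \<times> Sc) = c - a"
    using prob_Times_add_prob_Times_Diff[of S S] assms by (simp add: a_def c_def)
  \<comment> \<open>Equality of the marginals enters here: it turns P(W \<in> S) into
    \<open>c\<close>.\<close>
  moreover have ScS: "measure_pmf.prob p (Sc \<times> S) = c - a"
    using prob_Times_add_prob_Diff_Times[of S S] centrality_eq_prob_W[of S] assms
    by (simp add: a_def c_def)
  \<comment> \<open>This is \<open>(1 - c) - (c - a)\<close>, the rest of the mass of V \<in>
    Sc.\<close>
  moreover have "measure_pmf.prob p (Sc \<times> Sc) = 1 - 2 * c + a"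
    using prob_Times_add_prob_Times_Diff[of Sc S] ScS cSc assms by simp
  ultimately have rel: "relative_centrality p S S = a / c"
      "relative_centrality p Sc S = (c - a) / c"
      "relative_centrality p S Sc = (c - a) / (1 - c)"
      "relative_centrality p Sc Sc = (1 - 2 * c + a) / (1 - c)"
    by (simp_all add: relative_centrality_eq_prob_Times cSc a_def flip: c_def)
  have "is_community p S \<longleftrightarrow> c * c \<le> a"
    using c by (simp add: is_community_def community_strength_def rel field_simps flip: c_def)
  \<comment> \<open>Cross-multiplying gives \<open>c * (c - a) \<le> a * (1 - c)\<close>, where
    \<open>a * c\<close> cancels.\<close>
  moreover have "relative_centrality p S Sc \<le> relative_centrality p S S \<longleftrightarrow> c * c \<le> a"
    using c by (simp add: rel divide_le_eq le_divide_eq algebra_simps)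
  moreover have "relative_centrality p Sc S \<le> centrality p Sc \<longleftrightarrow> c * c \<le> a"
    using c by (simp add: rel cSc field_simps)
  moreover have "relative_centrality p S Sc \<le> centrality p S \<longleftrightarrow> c * c \<le> a"
    using c by (simp add: rel divide_le_eq algebra_simps flip: c_def)
  \<comment> \<open>Compare \<open>1 - 2 * c + a\<close> with the square of
    \<open>1 - c\<close>.\<close>
  moreover have "is_community p Sc \<longleftrightarrow> c * c \<le> a"
    using c by (simp add: is_community_def community_strength_def rel cSc field_simps)
  \<comment> \<open>In \<open>(c - a) * (1 - c) \<le> c * (1 - 2 * c + a)\<close> the terms
    \<open>c\<close> and \<open>a * c\<close> cancel.\<close>
  moreover have "relative_centrality p Sc S \<le> relative_centrality p Sc Sc \<longleftrightarrow> c * c \<le> a"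
    using c by (simp add: rel field_simps)
  ultimately show ?thesis
    by blast
qed

end
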